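(* Let $F_1$ and $F_2$ be two cumulative distribution functions on $\mathbb{R}$ such that $F_1\prec_{\rm st}F_2$. Then $G_\lambda[F_1]\prec_{\rm st}G_\lambda[F_2]$ for every $\lambda\in[-1,1]$.
   Context: For a univariate cumulative distribution function $F$ and $\lambda\in[-1,1]$, write $\bar F=1-F$ and define the cumulative distribution function $G_\lambda[F]$ by $G_{\lambda}[F](x)=F(x)\{1+\lambda\bar F(x)\}$ for all $x\in\mathbb{R}$. The stochastic order is defined by: $F_1\prec_{\rm st}F_2$ if $F_1(x)\geq F_2(x)$ for all $x$. *)

theory Defs
  imports "HOL-Probability.Distribution_Functions"
begin

definition is_cdf :: "(real \<Rightarrow> real) \<Rightarrow> bool"
  where "is_cdf F \<longleftrightarrow> (\<exists>M. real_distribution M \<and> F = cdf M)"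

definition G :: "real \<Rightarrow> (real \<Rightarrow> real) \<Rightarrow> real \<Rightarrow> real"
  where "G lam F x = F x * (1 + lam * (1 - F x))"

(* Larger distributions have smaller distribution functions, hence the reversed inequality.
   The relation is meant for F1 and F2 satisfying is_cdf. *)
definition st_le :: "(real \<Rightarrow> real) \<Rightarrow> (real \<Rightarrow> real) \<Rightarrow> bool"  (infix "\<prec>st" 50)
  where "F1 \<prec>st F2 \<longleftrightarrow> (\<forall>x. F1 x \<ge> F2 x)"

(* G maps distribution functions to distribution functions, so that st_le may be applied to
   its values. *)
lemma is_cdf_G:
  assumes "is_cdf F" and l: "lam \<in> {-1..1}"
  shows "is_cdf (G lam F)"
proof -
  obtain M where M: "real_distribution M" and F: "F = cdf M"
    using assms(1) by (auto simp: is_cdf_def)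
  interpret real_distribution M by (rule M)
  have G: "G lam F = (\<lambda>x. F x * (1 + lam * (1 - F x)))"
    by (auto simp: G_def)
  have mono: "G lam F x \<le> G lam F y" if "x \<le> y" for x y
  proof -
    have xy: "F x \<le> F y" "0 \<le> F x" "F y \<le> 1"
      using that by (auto simp: F cdf_nondecreasing cdf_nonneg cdf_bounded_prob)
    have "\<bar>lam * (1 - F x - F y)\<bar> \<le> 1 * 1"
      unfolding abs_mult using l xy by (intro mult_mono) auto
    then have "0 \<le> (F y - F x) * (1 + lam * (1 - F x - F y))"
      using xy by (intro mult_nonneg_nonneg) auto
    also have "\<dots> = G lam F y - G lam F x"
      by (simp add: G_def algebra_simps)
    finally show ?thesis by simp
  qed
  have cont: "continuous (at_right a) (G lam F)" for a
    unfolding G unfolding F by (intro continuous_intros cdf_is_right_cont)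
  have "((\<lambda>x. F x * (1 + lam * (1 - F x))) \<longlongrightarrow> 0 * (1 + lam * (1 - 0))) at_bot"
    unfolding F by (intro tendsto_intros cdf_lim_at_bot)
  then have bot: "(G lam F \<longlongrightarrow> 0) at_bot" by (simp add: G)
  have "((\<lambda>x. F x * (1 + lam * (1 - F x))) \<longlongrightarrow> 1 * (1 + lam * (1 - 1))) at_top"
    unfolding F by (intro tendsto_intros cdf_lim_at_top_prob)
  then have top: "(G lam F \<longlongrightarrow> 1) at_top" by (simp add: G)
  show ?thesis
    unfolding is_cdf_def
    using real_distribution_interval_measure[OF mono cont bot top]
      cdf_interval_measure[OF mono cont bot] by metis
qed

end

theory Submission
  imports Defs
begin

text \<open>\<open>G lam F\<close> is \<open>F\<close> followed by the distortion
  \<open>u * (1 + lam * (1 - u))\<close>, which is nondecreasing on [0,1] when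
  \<open>\<bar>lam\<bar> \<le> 1\<close> (\<open>distortion_mono\<close>). Composing with it
  therefore preserves pointwise inequalities between functions with values in [0,1].\<close>

lemma is_cdf_bounds:
  assumes "is_cdf F"
  shows "0 \<le> F x" and "F x \<le> 1"
proof -
  obtain M where M: "real_distribution M" and F: "F = cdf M"
    using assms by (auto simp: is_cdf_def)
  interpret real_distribution M by (rule M)
  show "0 \<le> F x" and "F x \<le> 1"
    by (auto simp: F cdf_nonneg cdf_bounded_prob)
qed

text \<open>Right side minus left side factors as \<open>(v - u) * (1 + lam * (1 - u - v))\<close>;
  the second factor is nonnegative because \<open>1 - u - v\<close> lies in [-1,1].\<close>

lemma distortion_mono:
  fixes u v lam :: real
  assumes "\<bar>lam\<bar> \<le> 1" and "0 \<le> u" and "u \<le> v" and "v \<le> 1"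
  shows "u * (1 + lam * (1 - u)) \<le> v * (1 + lam * (1 - v))"
proof -
  have "\<bar>lam * (1 - u - v)\<bar> \<le> 1 * 1"
    unfolding abs_mult using assms by (intro mult_mono) auto
  then have "0 \<le> (v - u) * (1 + lam * (1 - u - v))"
    using assms by (intro mult_nonneg_nonneg) auto
  also have "\<dots> = v * (1 + lam * (1 - v)) - u * (1 + lam * (1 - u))"
    by (simp add: algebra_simps)
  finally show ?thesis by simp
qed

theorem proposition3:
  fixes F1 F2 :: "real \<Rightarrow> real"
  assumes "is_cdf F1" and "is_cdf F2"
    and "F1 \<prec>st F2"
  shows "\<forall>lam\<in>{-1..1}. G lam F1 \<prec>st G lam F2"
  \<comment> \<open>At each \<open>x\<close>, monotonicity is used with \<open>u = F2 x\<close> and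
    \<open>v = F1 x\<close>.\<close>
  using assms by (auto simp: st_le_def G_def is_cdf_bounds intro!: distortion_mono)

end
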